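(* Let $(\mathcal{B},\mu)$ be a strictly positive atomless normalized measure algebra. For $n\ge2$ and $F:[0,1]^n\to[0,1]$ define $$\mathcal{E}_n(F)=\sup_{a_1,\ldots,a_n\in\mathcal{B}}\left|\mu\left(\bigwedge_{i=1}^n a_i\right)-F(\mu(a_1),\ldots,\mu(a_n))\right|.$$ Then $\inf_F\mathcal{E}_n(F)=\frac{n-1}{2n}$, the infimum being over all $F:[0,1]^n\to[0,1]$. Moreover, for fixed marginals $x_1,\ldots,x_n\in[0,1]$, the unique number $r$ minimizing $$\sup\left\{\left|\mu\left(\bigwedge_{i=1}^n a_i\right)-r\right| : a_i\in\mathcal{B},\ \mu(a_i)=x_i\ (1\le i\le n)\right\}$$ is the midpoint of the interval $\left[\left(\sum_{i=1}^n x_i-(n-1)\right)^+,\ \min_{1\le i\le n}x_i\right]$.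
   Context: A strictly positive atomless normalized measure algebra $(\mathcal{B},\mu)$ is a Dedekind $\sigma$-complete Boolean algebra $\mathcal{B}$ with a countably additive $\mu:\mathcal{B}\to[0,1]$ such that $\mu(1)=1$, $\mu(a)>0$ for every $a\neq 0$, and $\mathcal{B}$ has no atoms. Here $t^+=\max\{t,0\}$. *)

theory Defs
  imports "HOL-Analysis.Analysis"
begin

text \<open>
  A Dedekind \<open>\<sigma>\<close>-complete Boolean algebra is a type of sort
  \<open>{boolean_algebra, countable_complete_lattice}\<close>: countable sets have suprema and infima, given by
  \<open>Sup\<close> and \<open>Inf\<close>; the values of these operations on uncountable sets are unconstrained.
\<close>

definition atom :: "'a::boolean_algebra \<Rightarrow> bool" where
  "atom a \<longleftrightarrow> a \<noteq> bot \<and> (\<forall>b. b \<le> a \<longrightarrow> b = bot \<or> b = a)"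

locale atomless_normalized_measure_algebra =
  fixes \<mu> :: "'a::{boolean_algebra, countable_complete_lattice} \<Rightarrow> real"
  assumes range_unit: "\<mu> a \<in> {0..1}"
    and countably_additive:
      "(\<And>i j :: nat. i \<noteq> j \<Longrightarrow> inf (A i) (A j) = bot) \<Longrightarrow> (\<lambda>i. \<mu> (A i)) sums \<mu> (SUP i. A i)"
    and normalized: "\<mu> top = 1"
    and strictly_positive: "a \<noteq> bot \<Longrightarrow> 0 < \<mu> a"
    and atomless: "\<not> atom a"

text \<open>Points of \<open>[0,1]\<^sup>n\<close> are represented by their extensional coordinate functions on \<open>{1..n}\<close>.\<close>

definition unit_cube :: "nat \<Rightarrow> (nat \<Rightarrow> real) set" where
  "unit_cube n = {1..n} \<rightarrow>\<^sub>E {0..1}"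

text \<open>
  The two suprema below are over sets of reals that are bounded above (by \<open>1\<close> for \<open>F\<close> with values
  in the unit interval, by \<open>1 + \<bar>r\<bar>\<close> in the second case), and the sets are nonempty (in the
  second case because an atomless algebra has elements of every measure in the unit interval).
  The values of the sequence \<open>a\<close> outside \<open>{1..n}\<close> are irrelevant.
\<close>

definition worst_case_error ::
  "('a::{boolean_algebra, countable_complete_lattice} \<Rightarrow> real) \<Rightarrow> nat \<Rightarrow> ((nat \<Rightarrow> real) \<Rightarrow> real) \<Rightarrow> real"
where
  "worst_case_error \<mu> n F =
     (SUP a :: nat \<Rightarrow> 'a. \<bar>\<mu> (INF i\<in>{1..n}. a i) - F (\<lambda>i\<in>{1..n}. \<mu> (a i))\<bar>)"

definition marginal_error ::
  "('a::{boolean_algebra, countable_complete_lattice} \<Rightarrow> real) \<Rightarrow> nat \<Rightarrow> (nat \<Rightarrow> real) \<Rightarrow> real \<Rightarrow> real"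
where
  "marginal_error \<mu> n x r =
     (SUP a \<in> {a :: nat \<Rightarrow> 'a. \<forall>i\<in>{1..n}. \<mu> (a i) = x i}. \<bar>\<mu> (INF i\<in>{1..n}. a i) - r\<bar>)"

end

theory Submission
  imports Defs
begin

text \<open>
  For fixed marginals \<open>x\<close> the value \<open>\<mu> (a\<^sub>1 \<and> \<dots> \<and> a\<^sub>n)\<close> lies in the Frechet interval \<open>[L, U]\<close> with
  \<open>L = (\<Sum> x\<^sub>i - (n - 1))\<^sup>+\<close> and \<open>U = min x\<^sub>i\<close>, and both endpoints are attained because an atomless
  algebra has elements of every measure below any given element. Hence the worst error of a
  constant \<open>r\<close> is \<open>\<bar>r - (L + U) / 2\<bar> + (U - L) / 2\<close>, which is minimal exactly at the midpoint. The
  length \<open>U - L\<close> is at most \<open>(n - 1) / n\<close>, with equality when all marginals are \<open>(n - 1) / n\<close>.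
\<close>

section \<open>Finite additivity and continuity from below\<close>

context atomless_normalized_measure_algebra
begin

lemma mu_nonneg: "0 \<le> \<mu> a" and mu_le_1: "\<mu> a \<le> 1"
  using range_unit[of a] by auto

text \<open>The constant sequence \<open>bot\<close> is pairwise disjoint, and a constant series
  converges only when its term is 0.\<close>

lemma mu_bot: "\<mu> bot = 0"
proof -
  have "(\<lambda>i::nat. \<mu> bot) sums \<mu> (SUP i::nat. bot)"
    by (rule countably_additive) simp
  then show ?thesis
    by (simp add: sums_iff summable_const_iff)
qed

lemma mu_sup_disjoint:
  assumes "inf a b = bot"
  shows "\<mu> (sup a b) = \<mu> a + \<mu> b"
proof -
  define A where "A = (\<lambda>i::nat. if i = 0 then a else if i = 1 then b else bot)"
  have "(\<lambda>i. \<mu> (A i)) sums \<mu> (SUP i. A i)"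
    by (rule countably_additive) (use assms in \<open>auto simp: A_def inf_commute\<close>)
  moreover have "(SUP i. A i) = sup a b"
  proof (rule order.antisym)
    show "(SUP i. A i) \<le> sup a b"
      by (rule ccSUP_least) (auto simp: A_def)
    have "A 0 \<le> (SUP i. A i)" "A 1 \<le> (SUP i. A i)"
      by (rule ccSUP_upper; simp)+
    then show "sup a b \<le> (SUP i. A i)"
      by (simp add: A_def)
  qed
  moreover have "(\<lambda>i. \<mu> (A i)) sums (\<Sum>i\<in>{0,1}. \<mu> (A i))"
    by (rule sums_finite) (auto simp: A_def mu_bot)
  ultimately show ?thesis
    using sums_unique2 by (fastforce simp: A_def)
qed

lemma mu_diff:
  assumes "c \<le> b"
  shows "\<mu> (b - c) = \<mu> b - \<mu> c"
proof -
  have "sup c (b - c) = b"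
    using assms by (simp add: diff_eq sup_inf_distrib1 sup_absorb2)
  moreover have "inf c (b - c) = bot"
    by (simp add: diff_eq inf.left_commute)
  ultimately show ?thesis
    using mu_sup_disjoint[of c "b - c"] by simp
qed

lemma mu_compl: "\<mu> (- a) = 1 - \<mu> a"
  using mu_diff[of a top] by (simp add: diff_eq normalized)

lemma mu_mono: "a \<le> b \<Longrightarrow> \<mu> a \<le> \<mu> b"
  using mu_diff[of a b] mu_nonneg[of "b - a"] by simp

lemma mu_inf_diff: "\<mu> a = \<mu> (inf a b) + \<mu> (inf a (- b))"
proof -
  have "sup (inf a b) (inf a (- b)) = a"
    by (simp add: inf_sup_distrib1[symmetric])
  moreover have "inf (inf a b) (inf a (- b)) = bot"
    by (simp add: inf.assoc inf.left_commute)
  ultimately show ?thesis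
    by (metis mu_sup_disjoint)
qed

text \<open>The part of \<open>a\<close> outside \<open>b\<close> lies below \<open>- b\<close>,
  which has measure \<open>1 - \<mu> b\<close>. This is the binary Frechet lower bound.\<close>

lemma mu_inf_lower: "\<mu> a + \<mu> b - 1 \<le> \<mu> (inf a b)"
  using mu_inf_diff[of a b] mu_mono[of "inf a (- b)" "- b"] by (simp add: mu_compl)

text \<open>The increments of \<open>c\<close> are pairwise disjoint, have the same supremum as
  \<open>c\<close>, and their measures telescope to \<open>\<mu> (c k)\<close>; so countable
  additivity becomes continuity from below.\<close>

lemma mu_incseq:
  fixes c :: "nat \<Rightarrow> 'a"
  assumes "\<And>k. c k \<le> c (Suc k)"
  shows "(\<lambda>k. \<mu> (c k)) \<longlonglongrightarrow> \<mu> (SUP k. c k)"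
proof -
  have mono: "c i \<le> c j" if "i \<le> j" for i j
    using lift_Suc_mono_le[of c] assms that by blast
  define A where "A = (\<lambda>i. if i = 0 then c 0 else c i - c (i - 1))"
  have le: "A i \<le> c i" for i
    by (simp add: A_def diff_eq)
  have disj: "inf (A i) (A j) = bot" if "i < j" for i j
  proof -
    have "A i \<le> c (j - 1)"
      using order.trans[OF le[of i] mono[of i "j - 1"]] that by simp
    moreover have "A j \<le> - c (j - 1)"
      using that by (simp add: A_def diff_eq)
    ultimately have "inf (A i) (A j) \<le> inf (c (j - 1)) (- c (j - 1))"
      by (rule inf_mono)
    then show ?thesis
      by (simp add: bot_unique)
  qed
  have "(\<lambda>i. \<mu> (A i)) sums \<mu> (SUP i. A i)"
  proof (rule countably_additive)
    fix i j :: nat assume "i \<noteq> j"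
    then show "inf (A i) (A j) = bot"
      using disj[of i j] disj[of j i] by (metis inf_commute nat_neq_iff)
  qed
  moreover have "(SUP i. A i) = (SUP i. c i)"
  proof (rule order.antisym)
    show "(SUP i. A i) \<le> (SUP i. c i)"
      by (rule ccSUP_mono) (use le in auto)
    have "c k \<le> (SUP i. A i)" for k
    proof (induction k)
      case 0
      have "A 0 \<le> (SUP i. A i)"
        by (rule ccSUP_upper) auto
      then show ?case
        by (simp add: A_def)
    next
      case (Suc k)
      have "A (Suc k) \<le> (SUP i. A i)"
        by (rule ccSUP_upper) auto
      moreover have "c (Suc k) \<le> sup (c k) (A (Suc k))"
        by (simp add: A_def diff_eq sup_inf_distrib1)
      ultimately show ?case
        using Suc by (meson order.trans sup_least)
    qed
    then show "(SUP i. c i) \<le> (SUP i. A i)"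
      by (intro ccSUP_least) auto
  qed
  moreover have "(\<Sum>i\<le>k. \<mu> (A i)) = \<mu> (c k)" for k
    by (induction k) (simp_all add: A_def mu_diff assms)
  ultimately show ?thesis
    by (simp add: sums_def_le)
qed

section \<open>Elements of prescribed measure\<close>

lemma halving:
  assumes "b \<noteq> bot"
  obtains c where "c \<le> b" "c \<noteq> bot" "\<mu> c \<le> \<mu> b / 2"
proof -
  obtain d where d: "d \<le> b" "d \<noteq> bot" "d \<noteq> b"
    using atomless[of b] assms unfolding atom_def by blast
  have "b - d \<noteq> bot"
    using d mu_diff[of d b] by (metis diff_eq inf_shunt double_compl order.antisym)
  moreover have "b - d \<le> b"
    by (simp add: diff_eq)
  \<comment> \<open>Both \<open>d\<close> and \<open>b - d\<close> are nonzero and their measures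
    add up to \<open>\<mu> b\<close>, so one of them has at most half.\<close>
  ultimately show thesis
    using that[of d] that[of "b - d"] d mu_diff[of d b] by fastforce
qed

lemma small_element:
  assumes "b \<noteq> bot" "0 < e"
  obtains c where "c \<le> b" "c \<noteq> bot" "\<mu> c \<le> e"
proof -
  have *: "\<exists>c\<le>b. c \<noteq> bot \<and> \<mu> c \<le> (1 / 2) ^ k" for k
  proof (induction k)
    case 0
    then show ?case
      using assms mu_le_1 by auto
  next
    case (Suc k)
    then obtain c where c: "c \<le> b" "c \<noteq> bot" "\<mu> c \<le> (1 / 2) ^ k"
      by blast
    obtain d where "d \<le> c" "d \<noteq> bot" "\<mu> d \<le> \<mu> c / 2"
      using halving[OF c(2)] .
    then show ?case
      using c by (intro exI[of _ d]) auto
  qed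
  obtain k where "(1 / 2) ^ k < e"
    using real_arch_pow_inv[of e "1 / 2"] assms by auto
  with *[of k] that show thesis
    by (meson less_eq_real_def order.trans)
qed

text \<open>
  Greedy exhaustion: each step realises at least half of the largest possible gain below the
  target measure \<open>t\<close>, so the supremum of the steps admits no further gain.
\<close>
lemma element_of_measure:
  assumes "0 \<le> t" "t \<le> \<mu> b"
  obtains c where "c \<le> b" "\<mu> c = t"
proof -
  let ?P = "\<lambda>c. c \<le> b \<and> \<mu> c \<le> t"
  \<comment> \<open>The inequality says that \<open>c'\<close> gains at least half of what any
    admissible \<open>d\<close> gains over \<open>c\<close>; in this form it passes to
    limits.\<close>
  let ?Q = "\<lambda>c c'. c \<le> c' \<and> (\<forall>d. c \<le> d \<and> ?P d \<longrightarrow> \<mu> d + \<mu> c \<le> 2 * \<mu> c')"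
  \<comment> \<open>The supremum of the reachable measures need not be attained. If it equals
    \<open>\<mu> c\<close>, no gain is left and \<open>c\<close> is kept; otherwise some
    \<open>d\<close> passes the midpoint between \<open>\<mu> c\<close> and the supremum.\<close>
  have step: "\<exists>c'. ?P c' \<and> ?Q c c'" if c: "?P c" for c
  proof -
    let ?S = "{\<mu> d | d. c \<le> d \<and> ?P d}"
    have bdd: "bdd_above ?S"
      by (rule bdd_aboveI[of _ 1]) (use mu_le_1 in auto)
    have upper: "\<mu> d \<le> Sup ?S" if "c \<le> d" "?P d" for d
      using that by (intro cSup_upper bdd) auto
    show ?thesis
    proof (cases "Sup ?S = \<mu> c")
      case True
      then show ?thesis
        using c upper by (intro exI[of _ c]) fastforce
    next
      case False
      then have "(Sup ?S + \<mu> c) / 2 < Sup ?S"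
        using upper[of c] c by simp
      then obtain d where "c \<le> d" "?P d" "(Sup ?S + \<mu> c) / 2 < \<mu> d"
        using less_cSup_iff[OF _ bdd] c by blast
      then show ?thesis
        using upper by (intro exI[of _ d]) fastforce
    qed
  qed
  have start: "\<exists>c. ?P c"
    using assms mu_bot by (intro exI[of _ bot]) auto
  have "\<exists>c. \<forall>k. ?P (c k) \<and> ?Q (c k) (c (Suc k))"
    by (rule dependent_nat_choice[of "\<lambda>_. ?P" "\<lambda>_. ?Q"]) (rule start, rule step)
  then obtain c where c: "\<forall>k. ?P (c k) \<and> ?Q (c k) (c (Suc k))"
    by (rule exE)
  have P: "?P (c k)" and Q: "?Q (c k) (c (Suc k))" for k
    using spec[OF c, of k] by (rule conjunct1, rule conjunct2)
  define C where "C = (SUP k. c k)"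
  have lim: "(\<lambda>k. \<mu> (c k)) \<longlonglongrightarrow> \<mu> C"
    unfolding C_def by (rule mu_incseq) (use Q in blast)
  have C_le: "C \<le> b"
    unfolding C_def by (rule ccSUP_least) (use P in auto)
  have mu_C: "\<mu> C \<le> t"
    by (rule LIMSEQ_le_const2[OF lim]) (use P in auto)
  \<comment> \<open>If \<open>C\<close> fell short of \<open>t\<close>, a small nonzero
    \<open>e\<close> from the remainder \<open>b - C\<close> could be added without exceeding
    \<open>t\<close>.\<close>
  have "\<mu> C = t"
  proof (rule ccontr)
    assume "\<mu> C \<noteq> t"
    then have lt: "\<mu> C < t"
      using mu_C by simp
    have "0 < \<mu> (b - C)"
      using mu_diff[OF C_le] lt assms by linarith
    then have "b - C \<noteq> bot"
      by (metis less_irrefl mu_bot)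
    then obtain e where e: "e \<le> b - C" "e \<noteq> bot" "\<mu> e \<le> t - \<mu> C"
      using small_element[of "b - C" "t - \<mu> C"] lt by auto
    have "e \<le> b" "e \<le> - C"
      using e(1) by (auto simp: diff_eq)
    then have "inf C e = bot"
      by (metis inf_commute inf_shunt)
    then have mu_sup: "\<mu> (sup C e) = \<mu> C + \<mu> e"
      by (rule mu_sup_disjoint)
    \<comment> \<open>\<open>sup C e\<close> competes at every step, so in the limit the half-gain
      inequality would give \<open>\<mu> e \<le> 0\<close>.\<close>
    have le: "\<mu> (sup C e) + \<mu> (c k) \<le> 2 * \<mu> (c (Suc k))" for k
    proof -
      have "c k \<le> C"
        unfolding C_def by (rule ccSUP_upper) auto
      then have "c k \<le> sup C e"
        by (rule le_supI1)
      moreover have "?P (sup C e)"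
        using C_le \<open>e \<le> b\<close> mu_sup e(3) by auto
      ultimately show ?thesis
        using Q[of k] by blast
    qed
    have lim_l: "(\<lambda>k. \<mu> (sup C e) + \<mu> (c k)) \<longlonglongrightarrow> \<mu> (sup C e) + \<mu> C"
      by (intro tendsto_intros lim)
    have lim_r: "(\<lambda>k. 2 * \<mu> (c (Suc k))) \<longlonglongrightarrow> 2 * \<mu> C"
      by (intro tendsto_intros LIMSEQ_Suc[OF lim])
    have "\<mu> (sup C e) + \<mu> C \<le> 2 * \<mu> C"
      by (rule LIMSEQ_le[OF lim_l lim_r]) (use le in blast)
    then show False
      using mu_sup strictly_positive[OF e(2)] by simp
  qed
  then show thesis
    using that C_le by blast
qed

text \<open>Such an \<open>a\<close> is glued from a piece of \<open>b\<close> of measure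
  \<open>v\<close> and a piece of \<open>- b\<close> of measure \<open>x - v\<close>; the
  assumptions say that both pieces fit. Both Frechet endpoints are realised with it.\<close>

lemma element_with_inf_measure:
  assumes "0 \<le> v" "\<mu> b + x - 1 \<le> v" "v \<le> \<mu> b" "v \<le> x"
  obtains a where "\<mu> a = x" "\<mu> (inf b a) = v"
proof -
  obtain p where p: "p \<le> b" "\<mu> p = v"
    using element_of_measure[of v b] assms by blast
  obtain q where q: "q \<le> - b" "\<mu> q = x - v"
    using element_of_measure[of "x - v" "- b"] assms by (auto simp: mu_compl)
  have bq: "inf b q = bot"
    using q(1) by (metis inf_commute inf_shunt)
  then have "inf p q = bot"
    using p(1) by (metis bot_unique inf_mono order.refl)
  then have "\<mu> (sup p q) = x"
    using mu_sup_disjoint p q by simp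
  moreover have "inf b (sup p q) = p"
    using p(1) bq by (simp add: inf_sup_distrib1 inf_absorb2)
  then have "\<mu> (inf b (sup p q)) = v"
    using p(2) by simp
  ultimately show thesis
    by (rule that)
qed

end

section \<open>The Frechet bounds and their attainment\<close>

lemma INF_atLeastAtMost_Suc:
  fixes a :: "nat \<Rightarrow> 'a::countable_complete_lattice"
  shows "(INF i\<in>{1..Suc k}. a i) = inf (INF i\<in>{1..k}. a i) (a (Suc k))"
  by (simp add: atLeastAtMostSuc_conv inf_commute)

text \<open>The subtraction is in the reals, so the value at \<open>n = 0\<close> is 1, the measure
  of the empty infimum \<open>top\<close>; inductions can therefore start at 0.\<close>

definition frechet_lower :: "nat \<Rightarrow> (nat \<Rightarrow> real) \<Rightarrow> real" where
  "frechet_lower n x = max ((\<Sum>i=1..n. x i) - (real n - 1)) 0"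

definition frechet_upper :: "nat \<Rightarrow> (nat \<Rightarrow> real) \<Rightarrow> real" where
  "frechet_upper n x = (MIN i\<in>{1..n}. x i)"

context atomless_normalized_measure_algebra
begin

text \<open>By the binary bound, each further element costs at most
  \<open>1 - \<mu> (a (Suc n))\<close>; nonnegativity of the measure supplies the positive
  part.\<close>

lemma frechet_lower_le: "frechet_lower n (\<lambda>i. \<mu> (a i)) \<le> \<mu> (INF i\<in>{1..n}. a i)"
proof (induction n)
  case 0
  then show ?case
    by (simp add: frechet_lower_def normalized)
next
  case (Suc n)
  then show ?case
    unfolding INF_atLeastAtMost_Suc
    using mu_inf_lower[of "INF i\<in>{1..n}. a i" "a (Suc n)"]
      mu_nonneg[of "inf (INF i\<in>{1..n}. a i) (a (Suc n))"]
    by (simp add: frechet_lower_def)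
qed

lemma le_frechet_upper:
  assumes "n \<ge> 1"
  shows "\<mu> (INF i\<in>{1..n}. a i) \<le> frechet_upper n (\<lambda>i. \<mu> (a i))"
  unfolding frechet_upper_def using assms
  by (intro Min.boundedI) (auto intro!: mu_mono ccINF_lower)

text \<open>The elements are chosen one after another, each overlapping the infimum of the previous
  ones as little as possible.\<close>

lemma frechet_lower_attained:
  assumes "x \<in> unit_cube n"
  obtains a where "\<forall>i\<in>{1..n}. \<mu> (a i) = x i"
    "\<mu> (INF i\<in>{1..n}. a i) = frechet_lower n x"
proof -
  have x: "0 \<le> x i" "x i \<le> 1" if "i \<in> {1..n}" for i
    using assms that by (auto simp: unit_cube_def PiE_iff)
  have "\<exists>a. (\<forall>i\<in>{1..k}. \<mu> (a i) = x i) \<and> \<mu> (INF i\<in>{1..k}. a i) = frechet_lower k x"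
    if "k \<le> n" for k
    using that
  proof (induction k)
    case 0
    then show ?case
      by (simp add: frechet_lower_def normalized)
  next
    case (Suc k)
    then obtain a where a: "\<forall>i\<in>{1..k}. \<mu> (a i) = x i"
      "\<mu> (INF i\<in>{1..k}. a i) = frechet_lower k x"
      by auto
    let ?B = "INF i\<in>{1..k}. a i"
    have xk: "0 \<le> x (Suc k)" "x (Suc k) \<le> 1"
      using x Suc.prems by auto
    \<comment> \<open>Since \<open>x (Suc k) \<le> 1\<close>, this equals
      \<open>max (frechet_lower k x + x (Suc k) - 1) 0\<close>, the least possible overlap.\<close>
    let ?v = "frechet_lower (Suc k) x"
    have "0 \<le> ?v" "\<mu> ?B + x (Suc k) - 1 \<le> ?v" "?v \<le> \<mu> ?B" "?v \<le> x (Suc k)"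
      using xk mu_le_1[of ?B] unfolding a(2) by (auto simp: frechet_lower_def)
    then obtain b where b: "\<mu> b = x (Suc k)" "\<mu> (inf ?B b) = frechet_lower (Suc k) x"
      by (rule element_with_inf_measure)
    have "(INF i\<in>{1..k}. (a(Suc k := b)) i) = ?B"
      by (rule arg_cong[where f = Inf], rule image_cong) auto
    then have "\<mu> (INF i\<in>{1..Suc k}. (a(Suc k := b)) i) = frechet_lower (Suc k) x"
      unfolding INF_atLeastAtMost_Suc using b(2) by simp
    then show ?case
      using a(1) b(1) by (intro exI[of _ "a(Suc k := b)"]) (auto simp: le_Suc_eq)
  qed
  from this[OF order.refl] that show thesis
    by blast
qed

text \<open>All \<open>a i\<close> are chosen above one common element \<open>c\<close> whose
  measure is the smallest marginal, so their infimum lies above \<open>c\<close> too.\<close>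

lemma frechet_upper_attained:
  assumes "x \<in> unit_cube n" "n \<ge> 1"
  obtains a where "\<forall>i\<in>{1..n}. \<mu> (a i) = x i"
    "\<mu> (INF i\<in>{1..n}. a i) = frechet_upper n x"
proof -
  define m where "m = frechet_upper n x"
  have x: "0 \<le> x i" "x i \<le> 1" if "i \<in> {1..n}" for i
    using assms that by (auto simp: unit_cube_def PiE_iff)
  have m_le: "m \<le> x i" if "i \<in> {1..n}" for i
    using that by (auto simp: m_def frechet_upper_def)
  have "m \<in> x ` {1..n}"
    unfolding m_def frechet_upper_def using assms(2) by (intro Min_in) auto
  then have m: "0 \<le> m" "m \<le> 1"
    using x by auto
  obtain c where c: "\<mu> c = m"
    using element_of_measure[of m top] m normalized by auto
  have "\<exists>a. c \<le> a \<and> \<mu> a = x i" if i: "i \<in> {1..n}" for i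
  proof -
    obtain a where a: "\<mu> a = x i" "\<mu> (inf c a) = m"
      using element_with_inf_measure[of m c "x i"] x[OF i] m_le[OF i] m c by auto
    \<comment> \<open>\<open>a\<close> meets \<open>c\<close> in full measure; strict positivity
      turns this into \<open>c \<le> a\<close>.\<close>
    have "\<mu> (c - inf c a) = 0"
      using mu_diff[of "inf c a" c] a c by simp
    then have "c - inf c a = bot"
      using strictly_positive by fastforce
    then have "c \<le> a"
      by (metis diff_eq double_compl inf_shunt le_inf_iff)
    then show ?thesis
      using a by blast
  qed
  then obtain a where a: "\<And>i. i \<in> {1..n} \<Longrightarrow> c \<le> a i \<and> \<mu> (a i) = x i"
    by metis
  have "\<mu> (INF i\<in>{1..n}. a i) \<le> frechet_upper n (\<lambda>i. \<mu> (a i))"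
    by (rule le_frechet_upper) (rule assms)
  moreover have "frechet_upper n (\<lambda>i. \<mu> (a i)) = m"
    using a by (simp add: m_def frechet_upper_def cong: image_cong_simp)
  moreover have "c \<le> (INF i\<in>{1..n}. a i)"
    by (rule ccINF_greatest) (use a in auto)
  ultimately have "\<mu> (INF i\<in>{1..n}. a i) = m"
    using mu_mono c by fastforce
  then show thesis
    using that a m_def by blast
qed

lemma inf_measure_bounds:
  assumes "n \<ge> 1" "\<And>i. i \<in> {1..n} \<Longrightarrow> \<mu> (a i) = x i"
  shows "frechet_lower n x \<le> \<mu> (INF i\<in>{1..n}. a i)"
    and "\<mu> (INF i\<in>{1..n}. a i) \<le> frechet_upper n x"
proof -
  have "frechet_lower n (\<lambda>i. \<mu> (a i)) = frechet_lower n x"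
    using assms(2) by (simp add: frechet_lower_def cong: sum.cong_simp)
  then show "frechet_lower n x \<le> \<mu> (INF i\<in>{1..n}. a i)"
    using frechet_lower_le[of n a] by simp
  have "frechet_upper n (\<lambda>i. \<mu> (a i)) = frechet_upper n x"
    using assms(2) by (simp add: frechet_upper_def cong: image_cong_simp)
  then show "\<mu> (INF i\<in>{1..n}. a i) \<le> frechet_upper n x"
    using le_frechet_upper[OF assms(1), of a] by simp
qed

section \<open>Errors for fixed marginals and over the whole cube\<close>

lemma marginal_error_eq:
  assumes "x \<in> unit_cube n" "n \<ge> 1"
  shows "marginal_error \<mu> n x r =
    \<bar>r - midpoint (frechet_lower n x) (frechet_upper n x)\<bar> + (frechet_upper n x - frechet_lower n x) / 2"
proof -
  let ?L = "frechet_lower n x" and ?U = "frechet_upper n x"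
  let ?A = "{a :: nat \<Rightarrow> 'a. \<forall>i\<in>{1..n}. \<mu> (a i) = x i}"
  let ?f = "\<lambda>a. \<bar>\<mu> (INF i\<in>{1..n}. a i) - r\<bar>"
  obtain l where "\<forall>i\<in>{1..n}. \<mu> (l i) = x i" "\<mu> (INF i\<in>{1..n}. l i) = ?L"
    using frechet_lower_attained[OF assms(1)] .
  then have l: "l \<in> ?A" "\<mu> (INF i\<in>{1..n}. l i) = ?L"
    by simp_all
  obtain u where "\<forall>i\<in>{1..n}. \<mu> (u i) = x i" "\<mu> (INF i\<in>{1..n}. u i) = ?U"
    using frechet_upper_attained[OF assms] .
  then have u: "u \<in> ?A" "\<mu> (INF i\<in>{1..n}. u i) = ?U"
    by simp_all
  have LU: "?L \<le> ?U"
    using inf_measure_bounds(2)[OF assms(2), of l x] l by simp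
  \<comment> \<open>The error is a convex function of the measure, so on \<open>[?L, ?U]\<close> it
    is largest at an endpoint.\<close>
  have le: "?f a \<le> max \<bar>?L - r\<bar> \<bar>?U - r\<bar>" if "a \<in> ?A" for a
    using inf_measure_bounds[OF assms(2), of a x] that by simp
  have bdd: "bdd_above (?f ` ?A)"
    using le by (intro bdd_aboveI2)
  have "(SUP a\<in>?A. ?f a) = max \<bar>?L - r\<bar> \<bar>?U - r\<bar>"
  proof (rule order.antisym)
    show "(SUP a\<in>?A. ?f a) \<le> max \<bar>?L - r\<bar> \<bar>?U - r\<bar>"
      using le l(1) by (intro cSUP_least) blast+
    show "max \<bar>?L - r\<bar> \<bar>?U - r\<bar> \<le> (SUP a\<in>?A. ?f a)"
      using cSUP_upper[OF l(1) bdd] cSUP_upper[OF u(1) bdd] l(2) u(2) by simp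
  qed
  also have "\<dots> = \<bar>r - midpoint ?L ?U\<bar> + (?U - ?L) / 2"
    using LU by (simp add: midpoint_def max_def abs_if field_simps)
  finally show ?thesis
    by (simp add: marginal_error_def)
qed

text \<open>Sorting the sequences by their marginal vectors splits the supremum into one for each
  point of the cube. Comparing upper bounds \<open>e\<close> avoids a supremum of suprema.\<close>

lemma worst_case_error_le_iff:
  assumes "n \<ge> 1" "F \<in> unit_cube n \<rightarrow>\<^sub>E {0..1}"
  shows "worst_case_error \<mu> n F \<le> e \<longleftrightarrow> (\<forall>x\<in>unit_cube n. marginal_error \<mu> n x (F x) \<le> e)"
proof -
  let ?marg = "\<lambda>a. \<lambda>i\<in>{1..n}. \<mu> (a i)"
  let ?f = "\<lambda>a. \<bar>\<mu> (INF i\<in>{1..n}. a i) - F (?marg a)\<bar>"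
  have marg: "?marg a \<in> unit_cube n" for a
    using range_unit by (auto simp: unit_cube_def)
  have F: "0 \<le> F x" "F x \<le> 1" if "x \<in> unit_cube n" for x
    using assms(2) that by (auto simp: PiE_iff)
  have bdd: "bdd_above (range ?f)"
  proof (rule bdd_aboveI2)
    show "?f a \<le> 1" for a
      using F[OF marg[of a]] mu_nonneg[of "INF i\<in>{1..n}. a i"] mu_le_1[of "INF i\<in>{1..n}. a i"]
      by (simp add: abs_le_iff)
  qed
  \<comment> \<open>Points of the cube are extensional, so agreement on \<open>{1..n}\<close> is
    equality.\<close>
  have restrict: "?marg a = x"
    if "x \<in> unit_cube n" "\<forall>i\<in>{1..n}. \<mu> (a i) = x i" for a x
    using that by (intro ext) (auto simp: unit_cube_def PiE_iff extensional_def)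
  have pointwise: "worst_case_error \<mu> n F \<le> e \<longleftrightarrow> (\<forall>a. ?f a \<le> e)"
    unfolding worst_case_error_def using cSUP_le_iff[OF _ bdd, of e] by simp
  have fibres: "(\<forall>a. ?f a \<le> e) \<longleftrightarrow> (\<forall>x\<in>unit_cube n. \<forall>a\<in>{a. \<forall>i\<in>{1..n}. \<mu> (a i) = x i}.
      \<bar>\<mu> (INF i\<in>{1..n}. a i) - F x\<bar> \<le> e)"
  proof (intro iffI ballI allI)
    fix x a
    assume *: "\<forall>a. ?f a \<le> e" and x: "x \<in> unit_cube n" "a \<in> {a. \<forall>i\<in>{1..n}. \<mu> (a i) = x i}"
    have "?marg a = x"
      by (rule restrict) (use x in auto)
    then show "\<bar>\<mu> (INF i\<in>{1..n}. a i) - F x\<bar> \<le> e"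
      using spec[OF *, of a] by simp
  next
    fix a
    assume *: "\<forall>x\<in>unit_cube n. \<forall>a\<in>{a. \<forall>i\<in>{1..n}. \<mu> (a i) = x i}.
      \<bar>\<mu> (INF i\<in>{1..n}. a i) - F x\<bar> \<le> e"
    show "?f a \<le> e"
      by (rule *[THEN bspec, OF marg, THEN bspec]) simp
  qed
  have marginal: "(\<forall>a\<in>{a. \<forall>i\<in>{1..n}. \<mu> (a i) = x i}. \<bar>\<mu> (INF i\<in>{1..n}. a i) - F x\<bar> \<le> e) \<longleftrightarrow>
      marginal_error \<mu> n x (F x) \<le> e" if x: "x \<in> unit_cube n" for x
  proof -
    let ?A = "{a :: nat \<Rightarrow> 'a. \<forall>i\<in>{1..n}. \<mu> (a i) = x i}"
    obtain l where "\<forall>i\<in>{1..n}. \<mu> (l i) = x i"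
      by (rule frechet_lower_attained[OF x])
    then have "l \<in> ?A"
      by simp
    then have "?A \<noteq> {}"
      by blast
    moreover have "bdd_above ((\<lambda>a. \<bar>\<mu> (INF i\<in>{1..n}. a i) - F x\<bar>) ` ?A)"
    proof (rule bdd_aboveI2)
      show "\<bar>\<mu> (INF i\<in>{1..n}. a i) - F x\<bar> \<le> 1" for a
        using F[OF x] mu_nonneg[of "INF i\<in>{1..n}. a i"] mu_le_1[of "INF i\<in>{1..n}. a i"]
        by (simp add: abs_le_iff)
    qed
    ultimately show ?thesis
      unfolding marginal_error_def by (rule cSUP_le_iff[symmetric])
  qed
  show ?thesis
    unfolding pointwise fibres by (rule ball_cong[OF refl marginal])
qed

end

section \<open>Range and length of the Frechet interval\<close>

lemma frechet_upper_unit: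
  assumes "x \<in> unit_cube n" "n \<ge> 1"
  shows "frechet_upper n x \<in> {0..1}"
proof -
  have "frechet_upper n x \<in> x ` {1..n}"
    unfolding frechet_upper_def using assms(2) by (intro Min_in) auto
  then show ?thesis
    using assms(1) by (auto simp: unit_cube_def PiE_iff)
qed

lemma frechet_lower_unit:
  assumes "x \<in> unit_cube n"
  shows "frechet_lower n x \<in> {0..1}"
proof -
  have "(\<Sum>i=1..n. x i) \<le> real (card {1..n}) * 1"
    by (rule sum_bounded_above) (use assms in \<open>auto simp: unit_cube_def PiE_iff\<close>)
  then show ?thesis
    by (simp add: frechet_lower_def)
qed

text \<open>With \<open>m\<close> the minimum, the lower endpoint is at least
  \<open>n * m - (n - 1)\<close> and at least 0; averaging these bounds with weights
  \<open>1 / n\<close> and \<open>(n - 1) / n\<close> gives \<open>m - (n - 1) / n\<close>.\<close>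

lemma frechet_gap_le:
  assumes "n \<ge> 1" "x \<in> unit_cube n"
  shows "frechet_upper n x - frechet_lower n x \<le> (real n - 1) / real n"
proof -
  define m where "m = frechet_upper n x"
  have "real (card {1..n}) * m \<le> (\<Sum>i=1..n. x i)"
    by (rule sum_bounded_below) (simp add: m_def frechet_upper_def)
  then have L: "real n * m - (real n - 1) \<le> frechet_lower n x" "0 \<le> frechet_lower n x"
    by (auto simp: frechet_lower_def)
  have n: "real n \<ge> 1"
    using assms by simp
  have "real n * m - real n * frechet_lower n x \<le> real n - 1"
  proof -
    have "0 \<le> (real n - 1) * frechet_lower n x"
      using n L(2) by simp
    then show ?thesis
      using L(1) by (simp add: algebra_simps)
  qed
  then show ?thesis
    using n by (simp add: m_def field_simps)
qed

text \<open>These marginals add up to exactly \<open>n - 1\<close>, so the lower endpoint is 0 and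
  both bounds averaged in \<open>frechet_gap_le\<close> are equalities.\<close>

lemma frechet_gap_extremal:
  assumes "n \<ge> 1"
  defines "x \<equiv> (\<lambda>i\<in>{1..n}. (real n - 1) / real n)"
  shows "x \<in> unit_cube n" "frechet_upper n x - frechet_lower n x = (real n - 1) / real n"
proof -
  show "x \<in> unit_cube n"
    using assms by (auto simp: x_def unit_cube_def)
  have "(\<Sum>i=1..n. x i) = real n - 1"
    using assms by (simp add: x_def)
  moreover have "x ` {1..n} = {(real n - 1) / real n}"
    using assms by (auto simp: x_def image_def)
  ultimately show "frechet_upper n x - frechet_lower n x = (real n - 1) / real n"
    by (simp add: frechet_upper_def frechet_lower_def)
qed

section \<open>Optimality of the midpoint predictor\<close>

theorem theorem7:
  fixes \<mu> :: "'a::{boolean_algebra, countable_complete_lattice} \<Rightarrow> real"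
    and n :: nat
  assumes "atomless_normalized_measure_algebra \<mu>"
    and "n \<ge> 2"
  shows "(INF F \<in> unit_cube n \<rightarrow>\<^sub>E {0..1}. worst_case_error \<mu> n F) = (real n - 1) / (2 * real n)
    \<and> (\<forall>x \<in> unit_cube n. \<forall>r. is_arg_min (marginal_error \<mu> n x) (\<lambda>_. True) r \<longleftrightarrow>
         r = midpoint (max ((\<Sum>i=1..n. x i) - (real n - 1)) 0) (MIN i\<in>{1..n}. x i))"
proof (intro conjI ballI allI)
  interpret atomless_normalized_measure_algebra \<mu>
    by (rule assms)
  have n: "n \<ge> 1"
    using assms by simp
  let ?mid = "\<lambda>x. midpoint (frechet_lower n x) (frechet_upper n x)"
  let ?e = "(real n - 1) / (2 * real n)"
  \<comment> \<open>One vector with the longest Frechet interval forces this error: no value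
    \<open>F x\<close> is closer than half the length to both endpoints.\<close>
  have lower: "?e \<le> worst_case_error \<mu> n F" if F: "F \<in> unit_cube n \<rightarrow>\<^sub>E {0..1}" for F
  proof -
    define x where "x = (\<lambda>i\<in>{1..n}. (real n - 1) / real n)"
    note x = frechet_gap_extremal[OF n, folded x_def]
    have "?e \<le> marginal_error \<mu> n x (F x)"
      unfolding marginal_error_eq[OF x(1) n] x(2) by simp
    \<comment> \<open>Taking the worst-case error itself as \<open>e\<close> makes the left side of
      the equivalence trivially true.\<close>
    also have "\<dots> \<le> worst_case_error \<mu> n F"
      using worst_case_error_le_iff[OF n F, of "worst_case_error \<mu> n F"] x(1) by simp
    finally show ?thesis .
  qed
  \<comment> \<open>The midpoint predictor, restricted to the cube to be extensional; it attains the
    infimum.\<close>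
  define G where "G = restrict ?mid (unit_cube n)"
  have G: "G \<in> unit_cube n \<rightarrow>\<^sub>E {0..1}"
  proof (unfold G_def, rule restrict_PiE_iff[THEN iffD2], rule ballI)
    fix x assume "x \<in> unit_cube n"
    then show "?mid x \<in> {0..1}"
      using frechet_lower_unit frechet_upper_unit n by (fastforce simp: midpoint_def)
  qed
  have "marginal_error \<mu> n x (G x) \<le> ?e" if x: "x \<in> unit_cube n" for x
    using divide_right_mono[OF frechet_gap_le[OF n x], of 2] x
    unfolding marginal_error_eq[OF x n] by (simp add: G_def mult.commute)
  then have "worst_case_error \<mu> n G \<le> ?e"
    using worst_case_error_le_iff[OF n G] by blast
  then have eq: "worst_case_error \<mu> n G = ?e"
    using lower[OF G] by simp
  show "(INF F \<in> unit_cube n \<rightarrow>\<^sub>E {0..1}. worst_case_error \<mu> n F) = ?e"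
    by (rule cInf_eq_minimum) (use G eq lower in \<open>auto intro: rev_image_eqI\<close>)
  fix x r assume x: "x \<in> unit_cube n"
  \<comment> \<open>The half-length is the same for every \<open>r\<close> and cancels, leaving only
    the distance to the midpoint.\<close>
  have "is_arg_min (marginal_error \<mu> n x) (\<lambda>_. True) r \<longleftrightarrow> (\<forall>s. \<bar>r - ?mid x\<bar> \<le> \<bar>s - ?mid x\<bar>)"
    by (simp add: is_arg_min_def marginal_error_eq[OF x n] not_less)
  also have "\<dots> \<longleftrightarrow> r = ?mid x"
    by (auto dest: spec[of _ "?mid x"])
  finally show "is_arg_min (marginal_error \<mu> n x) (\<lambda>_. True) r \<longleftrightarrow>
      r = midpoint (max ((\<Sum>i=1..n. x i) - (real n - 1)) 0) (MIN i\<in>{1..n}. x i)"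
    by (simp add: frechet_lower_def frechet_upper_def)
qed

end
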